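(* Let $\mathcal{M}_3$ be the space of complex $3\times 3$ matrices, let $\Omega_3\subset\mathcal{M}_3\cong\mathbb{C}^9$ be the spectral unit ball, let $\omega:=e^{2\pi i/3}$, and put $$A:=\begin{pmatrix}0&0&0\\0&0&1\\0&0&0\end{pmatrix},\qquad B:=\begin{pmatrix}1&0&0\\0&\omega&0\\0&0&\omega^2\end{pmatrix}.$$ Then the following hold. (a) $\kappa_{\Omega_3}(A;B)>0=\widetilde{\mathcal{D}}l_{\Omega_3}(A;B)$. (b) Moreover, let $(t_j)_j\subset\mathbb{C}\setminus\{0\}$ and $(C_j)_j\subset\mathcal{M}_3$, with $C_j=(c_{k,l}^j)_{k,l=1,2,3}$, be sequences such that $t_j\to 0$, $C_j\to B$, and $$\liminf_{j\to\infty}\left|\frac{c_{3,2}^j}{t_j}-3\right|>0.$$ Then $$\lim_{j\to\infty}\frac{l_{\Omega_3}(A,A+t_jC_j)}{|t_j|}=0.$$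
   Context: $\mathbb{D}\subset\mathbb{C}$ is the open unit disc, and $\mathcal{O}(\mathbb{D},D)$ denotes the set of holomorphic maps from $\mathbb{D}$ to $D$. For a domain $D\subset\mathbb{C}^n$, $z,w\in D$ and $X\in\mathbb{C}^n$: - the Lempert function of $D$ is $l_D(z,w)=\inf\{|\alpha|:\ \alpha\in\mathbb{D},\ \exists\varphi\in\mathcal{O}(\mathbb{D},D):\ \varphi(0)=z,\ \varphi(\alpha)=w\}$; - the Kobayashi-Royden pseudometric of $D$ is $\kappa_D(z;X)=\inf\{|\alpha|:\ \alpha\in\mathbb{C},\ \exists\varphi\in\mathcal{O}(\mathbb{D},D):\ \varphi(0)=z,\ \alpha\varphi'(0)=X\}$; - $\widetilde{\mathcal{D}}l_D(z;X):=\limsup_{t\to 0,\ t\in\mathbb{C}\setminus\{0\}}\dfrac{l_D(z,z+tX)}{|t|}$. The spectral unit ball $\Omega_3$ is the set of all matrices in $\mathcal{M}_3$ all of whose eigenvalues lie in $\mathbb{D}$; it is a domain in $\mathbb{C}^9$. In (b), $c_{k,l}^j$ is the entry of $C_j$ in row $k$ and column $l$, and $A+t_jC_j\in\Omega_3$ for all sufficiently large $j$, so the quotient is defined for such $j$. *)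

theory Defs
  imports "HOL-Complex_Analysis.Complex_Analysis"
begin

text \<open>Holomorphy and complex derivatives of maps into \<open>n\<close>-dimensional complex space
  are taken componentwise.\<close>

definition holomorphic_discs :: "(complex ^ 'n) set \<Rightarrow> (complex \<Rightarrow> complex ^ 'n) set" where
  "holomorphic_discs D =
     {\<phi>. (\<forall>i. (\<lambda>\<zeta>. \<phi> \<zeta> $ i) holomorphic_on ball 0 1) \<and> \<phi> ` ball 0 1 \<subseteq> D}"

definition complex_derivative :: "(complex \<Rightarrow> complex ^ 'n) \<Rightarrow> complex \<Rightarrow> complex ^ 'n" where
  "complex_derivative \<phi> \<zeta> = (\<chi> i. deriv (\<lambda>\<xi>. \<phi> \<xi> $ i) \<zeta>)"

text \<open>The infima are taken in \<^typ>\<open>ereal\<close>, so that the infimum of the empty set is infinite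
  rather than an unspecified real, and so that the upper limit below always exists.\<close>

definition lempert :: "(complex ^ 'n) set \<Rightarrow> complex ^ 'n \<Rightarrow> complex ^ 'n \<Rightarrow> ereal" where
  "lempert D z w =
     Inf {ereal (cmod \<alpha>) | \<alpha>. \<alpha> \<in> ball 0 1 \<and>
            (\<exists>\<phi> \<in> holomorphic_discs D. \<phi> 0 = z \<and> \<phi> \<alpha> = w)}"

definition kobayashi_royden :: "(complex ^ 'n) set \<Rightarrow> complex ^ 'n \<Rightarrow> complex ^ 'n \<Rightarrow> ereal" where
  "kobayashi_royden D z X =
     Inf {ereal (cmod \<alpha>) | \<alpha>.
            \<exists>\<phi> \<in> holomorphic_discs D. \<phi> 0 = z \<and> \<alpha> *s complex_derivative \<phi> 0 = X}"

definition lempert_derivative :: "(complex ^ 'n) set \<Rightarrow> complex ^ 'n \<Rightarrow> complex ^ 'n \<Rightarrow> ereal" where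
  "lempert_derivative D z X =
     Limsup (at 0) (\<lambda>t::complex. lempert D z (z + t *s X) / ereal (cmod t))"

definition spectral_unit_ball :: "(complex ^ 'n ^ 'n) set" where
  "spectral_unit_ball =
     {M. \<forall>\<mu>. (\<exists>v. v \<noteq> 0 \<and> M *v v = \<mu> *s v) \<longrightarrow> \<mu> \<in> ball 0 1}"

text \<open>The identification of the space of complex \<open>n \<times> n\<close> matrices with \<open>n\<^sup>2\<close>-dimensional
  complex space; coordinates are indexed by (row, column).\<close>

definition vec_of_matrix :: "complex ^ 'n ^ 'n \<Rightarrow> complex ^ ('n \<times> 'n)" where
  "vec_of_matrix M = (\<chi> p. M $ fst p $ snd p)"

end

theory Submission
  imports Defs "HOL-Computational_Algebra.Fundamental_Theorem_Algebra"
begin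

text \<open>
  Write \<open>\<sigma>\<^sub>1, \<sigma>\<^sub>2, \<sigma>\<^sub>3\<close> for the trace, the sum of the principal \<open>2 \<times> 2\<close> minors and the
  determinant. Whether a matrix lies in \<open>\<Omega>\<close> depends on these three numbers only, so everything is
  governed by how fast they vanish along a disc through the nilpotent matrix \<open>A\<close>, and by the question
  which triples of functions are the invariants of a holomorphic family starting at \<open>A\<close>.

  \<^bold>\<open>Small discs.\<close> Let \<open>M = A + t C\<close> with \<open>C\<close> close to \<open>B\<close>. Since \<open>1 + \<omega> + \<omega>\<^sup>2 = 0\<close> and \<open>C\<^sub>3\<^sub>2\<close> is
  small, \<open>\<sigma>\<^sub>1(M)\<close> and \<open>\<sigma>\<^sub>2(M)\<close> are \<open>o(t)\<close> and \<open>\<sigma>\<^sub>3(M)\<close> is \<open>o(t\<^sup>2)\<close>. The matrix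
    \<open>F(z) = (0 z 0; 0 0 1; \<sigma>\<^sub>3 z, -\<sigma>\<^sub>2 z, \<sigma>\<^sub>1 z)\<close>
  has invariants \<open>\<sigma>\<^sub>1 z, \<sigma>\<^sub>2 z, \<sigma>\<^sub>3 z\<^sup>2\<close>, equals \<open>A\<close> at \<open>z = 0\<close> and is the companion matrix of \<open>M\<close> at
  \<open>z = 1\<close>. With \<open>\<alpha> = \<epsilon> t\<close>, the disc \<open>\<zeta> \<mapsto> F(\<zeta>/\<alpha>)\<close> therefore stays in \<open>\<Omega>\<close> as soon as \<open>t\<close> is small. If
  \<open>M\<close> has a cyclic row vector \<open>v\<close>, then the matrix \<open>Q\<close> with rows \<open>v, v M, v M\<^sup>2\<close> conjugates \<open>F(1)\<close> into
  \<open>M\<close>, and conjugating \<open>F(\<zeta>/\<alpha>)\<close> by an entire curve of invertible matrices from the identity to \<open>Q\<close>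
  gives a disc from \<open>A\<close> to \<open>M\<close> that reaches \<open>M\<close> at \<open>\<alpha>\<close> (\<open>lempert_le_of_krylov_joined\<close>).

  \<^bold>\<open>Where the number 3 comes from.\<close> For \<open>v = (1, x, 0)\<close> the determinant of \<open>Q\<close> is a cubic polynomial
  in \<open>x\<close> whose quadratic coefficient, divided by \<open>t\<^sup>2\<close>, is \<open>e - g C\<^sub>3\<^sub>2/t\<close> with \<open>e\<close> tending to \<open>3\<close> and \<open>g\<close>
  tending to \<open>1\<close> (\<open>krylov_x2_coeff_perturbed\<close>). So as long as \<open>C\<^sub>3\<^sub>2/t\<close> stays away from \<open>3\<close>, some \<open>x\<close> gives a
  cyclic vector. The constant sequence \<open>C = B\<close>, where \<open>C\<^sub>3\<^sub>2/t = 0\<close>, yields the vanishing of the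
  derivative of the Lempert function.

  \<^bold>\<open>Positivity.\<close> Along a disc with \<open>\<phi>(0) = A\<close> and \<open>\<alpha> \<phi>'(0) = B\<close>, let \<open>y\<close> be the second Taylor coefficient
  of the entry \<open>(3, 2)\<close>. Then \<open>\<sigma>\<^sub>2 = - y \<zeta>\<^sup>2 + \<dots>\<close> and \<open>\<sigma>\<^sub>3 = (1/\<alpha>) (1/\<alpha>\<^sup>2 - y) \<zeta>\<^sup>3 + \<dots>\<close>. Both functions are
  bounded on the disc, so Cauchy's estimates bound first \<open>y\<close> and then \<open>1/\<alpha>\<close>.
\<close>

text \<open>The dollar sign is reserved for components of vectors.\<close>

no_notation fps_nth (infixl "$" 75)

section \<open>Entire curves of invertible matrices\<close>

definition entire_matrix :: "(complex \<Rightarrow> complex ^ 'n ^ 'm) \<Rightarrow> bool" where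
  "entire_matrix R \<longleftrightarrow> (\<forall>i j. (\<lambda>z. R z $ i $ j) holomorphic_on UNIV)"

text \<open>The inverses are part of the data, so that conjugation by the curve is visibly holomorphic.\<close>

definition joined_to_identity :: "complex ^ 'n ^ 'n \<Rightarrow> bool" where
  "joined_to_identity Q \<longleftrightarrow>
     (\<exists>R S. entire_matrix R \<and> entire_matrix S \<and> (\<forall>z. S z ** R z = mat 1) \<and>
            R 0 = mat 1 \<and> R 1 = Q)"

lemma entire_matrix_mult:
  assumes "entire_matrix R" and "entire_matrix S"
  shows "entire_matrix (\<lambda>z. R z ** S z)"
  using assms unfolding entire_matrix_def matrix_matrix_mult_def
  by (auto intro!: holomorphic_intros)

lemma joined_to_identity_mat_1: "joined_to_identity (mat 1)"
  unfolding joined_to_identity_def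
  by (intro exI[of _ "\<lambda>_. mat 1"]) (auto simp: entire_matrix_def)

text \<open>If \<open>Q\<close> and \<open>Q'\<close> differ in one row, then \<open>G = Q' Q\<^sup>-\<^sup>1\<close> differs from the identity by a matrix
  \<open>E\<close> of rank at most one, for which \<open>E\<^sup>2 = (g - 1) E\<close>. Hence the matrices \<open>1 + a E\<close> are closed under
  products, and \<open>G\<close> lies on a one-parameter subgroup of this form: a unipotent one if \<open>g = 1\<close>, an
  exponential one otherwise.\<close>

lemma joined_to_identity_replace_row:
  fixes Q Q' :: "complex ^ 'n ^ 'n"
  assumes "joined_to_identity Q"
    and rows: "\<And>k. k \<noteq> i \<Longrightarrow> Q' $ k = Q $ k"
    and det: "det Q' \<noteq> 0"
  shows "joined_to_identity Q'"
proof -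
  obtain R S where R: "entire_matrix R" and S: "entire_matrix S"
    and SR: "\<And>z. S z ** R z = mat 1" and R0: "R 0 = mat 1" and R1: "R 1 = Q"
    using assms(1) unfolding joined_to_identity_def by blast
  define G where "G = Q' ** S 1"
  have QS: "Q ** S 1 = mat 1"
    using SR[of 1] R1 matrix_left_right_inverse by blast
  have GQ: "G ** Q = Q'"
    using SR[of 1] R1 by (simp add: G_def matrix_mul_assoc[symmetric])
  define E where "E = G - mat 1"
  define g where "g = G $ i $ i"
  have E0: "E $ k $ j = 0" if "k \<noteq> i" for k j
  proof -
    have "G $ k $ j = (Q ** S 1) $ k $ j"
      using rows[OF that] by (simp add: G_def matrix_matrix_mult_def)
    then show ?thesis by (simp add: E_def QS)
  qed
  have EE: "(\<Sum>l\<in>UNIV. E $ k $ l * E $ l $ j) = (g - 1) * E $ k $ j" for k j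
  proof -
    have "(\<Sum>l\<in>UNIV. E $ k $ l * E $ l $ j) = (\<Sum>l\<in>UNIV. if l = i then E $ k $ i * E $ i $ j else 0)"
      by (intro sum.cong) (auto simp: E0)
    also have "\<dots> = E $ k $ i * E $ i $ j" by simp
    also have "\<dots> = (g - 1) * E $ k $ j"
    proof (cases "k = i")
      case True
      have "E $ i $ i = g - 1" by (simp add: E_def g_def mat_def)
      then show ?thesis using True by simp
    qed (simp add: E0)
    finally show ?thesis .
  qed
  \<comment> \<open>If \<open>g\<close> were zero, \<open>E\<^sup>2 = - E\<close> would give \<open>G E = 0\<close>, although \<open>G\<close> is invertible.\<close>
  have "g \<noteq> 0"
  proof
    assume g: "g = 0"
    have "(G ** E) $ k $ j = 0" for k j
    proof -
      have "(G ** E) $ k $ j = (\<Sum>l\<in>UNIV. (mat 1 $ k $ l + E $ k $ l) * E $ l $ j)"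
        by (simp add: E_def matrix_matrix_mult_def)
      also have "\<dots> = (mat 1 ** E) $ k $ j + (\<Sum>l\<in>UNIV. E $ k $ l * E $ l $ j)"
        by (simp add: algebra_simps sum.distrib matrix_matrix_mult_def)
      finally show ?thesis using EE[of k j] g by simp
    qed
    then have GE: "G ** E = 0" by (simp add: vec_eq_iff)
    have "det G \<noteq> 0" using det GQ by (metis det_mul mult_zero_left)
    then obtain H where "H ** G = mat 1"
      using invertible_det_nz invertible_left_inverse by blast
    then have "E = 0"
      using GE by (metis matrix_mul_assoc matrix_mul_lid times0_right)
    then show False using g by (simp add: E_def g_def mat_def)
  qed
  then obtain \<mu> where \<mu>: "exp \<mu> = g" using exp_Ln by blast
  \<comment> \<open>For \<open>g \<noteq> 1\<close> this solves \<open>1 + (g - 1) h(z) = exp (\<mu> z)\<close>; in both cases \<open>1 + h(-z) E\<close> inverts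
     \<open>1 + h(z) E\<close>.\<close>
  define h where "h z = (if g = 1 then z else (exp (\<mu> * z) - 1) / (g - 1))" for z
  define L where "L a = (\<chi> k j. mat 1 $ k $ j + a * E $ k $ j)" for a
  have LL: "L a ** L b = L (a + b + (g - 1) * a * b)" for a b
  proof -
    have "(L a ** L b) $ k $ j = L (a + b + (g - 1) * a * b) $ k $ j" for k j
    proof -
      have "(L a ** L b) $ k $ j =
          (\<Sum>l\<in>UNIV. mat 1 $ k $ l * mat 1 $ l $ j) + b * (\<Sum>l\<in>UNIV. mat 1 $ k $ l * E $ l $ j)
          + a * (\<Sum>l\<in>UNIV. E $ k $ l * mat 1 $ l $ j) + a * b * (\<Sum>l\<in>UNIV. E $ k $ l * E $ l $ j)"
        by (simp add: L_def matrix_matrix_mult_def algebra_simps sum.distrib sum_distrib_left)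
      also have "\<dots> = (mat 1 ** mat 1) $ k $ j + b * (mat 1 ** E) $ k $ j
          + a * (E ** mat 1) $ k $ j + a * b * ((g - 1) * E $ k $ j)"
        unfolding EE by (simp add: matrix_matrix_mult_def)
      also have "\<dots> = L (a + b + (g - 1) * a * b) $ k $ j"
        by (simp add: L_def algebra_simps)
      finally show ?thesis .
    qed
    then show ?thesis by (simp add: vec_eq_iff)
  qed
  have L0: "L 0 = mat 1" and L1: "L 1 = G"
    by (simp_all add: L_def vec_eq_iff E_def)
  have hneg: "h (- z) + h z + (g - 1) * h (- z) * h z = 0" for z
  proof (cases "g = 1")
    case False
    have "1 + (g - 1) * h y = exp (\<mu> * y)" for y
      using False by (simp add: h_def)
    then have "(1 + (g - 1) * h (- z)) * (1 + (g - 1) * h z) = 1"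
      by (simp add: exp_minus)
    then have "(g - 1) * (h (- z) + h z + (g - 1) * h (- z) * h z) = 0"
      by algebra
    then show ?thesis using False by simp
  qed (simp add: h_def)
  have h0: "h 0 = 0" and h1: "h 1 = 1" by (auto simp: h_def \<mu>)
  have hh: "h holomorphic_on UNIV" and hh': "(\<lambda>z. h (- z)) holomorphic_on UNIV"
    unfolding h_def by (cases "g = 1"; auto intro!: holomorphic_intros)+
  have "entire_matrix (\<lambda>z. L (h z))" "entire_matrix (\<lambda>z. L (h (- z)))"
    unfolding entire_matrix_def L_def using hh hh' by (auto intro!: holomorphic_intros)
  then have "entire_matrix (\<lambda>z. L (h z) ** R z)" "entire_matrix (\<lambda>z. S z ** L (h (- z)))"
    by (auto intro: entire_matrix_mult R S)
  moreover have "(S z ** L (h (- z))) ** (L (h z) ** R z) = mat 1" for z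
  proof -
    have "(S z ** L (h (- z))) ** (L (h z) ** R z) = S z ** (L (h (- z)) ** L (h z)) ** R z"
      by (simp add: matrix_mul_assoc)
    then show ?thesis by (simp add: LL hneg L0 SR)
  qed
  ultimately show ?thesis
    unfolding joined_to_identity_def
    by (intro exI[of _ "\<lambda>z. L (h z) ** R z"] exI[of _ "\<lambda>z. S z ** L (h (- z))"])
       (auto simp: h0 h1 L0 L1 R0 R1 GQ)
qed

section \<open>Discs through a cyclic matrix\<close>

definition second_minor_sum :: "complex ^ 3 ^ 3 \<Rightarrow> complex" where
  "second_minor_sum M = M$1$1 * M$2$2 - M$1$2 * M$2$1 + (M$1$1 * M$3$3 - M$1$3 * M$3$1)
     + (M$2$2 * M$3$3 - M$2$3 * M$3$2)"

lemma spectral_unit_ball_similar: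
  fixes F R S :: "complex ^ 'n ^ 'n"
  assumes "F \<in> spectral_unit_ball" and SR: "S ** R = mat 1"
  shows "S ** F ** R \<in> spectral_unit_ball"
proof -
  have "\<mu> \<in> ball 0 1" if v: "v \<noteq> 0" "(S ** F ** R) *v v = \<mu> *s v" for \<mu> v
  proof -
    have RS: "R ** S = mat 1" using SR matrix_left_right_inverse by blast
    have "R *v v \<noteq> 0"
      using v(1) SR by (metis matrix_vector_mul_assoc matrix_vector_mul_lid matrix_vector_mult_0_right)
    moreover have "F *v (R *v v) = \<mu> *s (R *v v)"
    proof -
      have "R *v ((S ** F ** R) *v v) = (R ** S) *v (F *v (R *v v))"
        by (simp add: matrix_vector_mul_assoc matrix_mul_assoc)
      then show ?thesis by (simp add: v(2) RS vector_scalar_commute)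
    qed
    ultimately show ?thesis using assms(1) unfolding spectral_unit_ball_def by blast
  qed
  then show ?thesis unfolding spectral_unit_ball_def by blast
qed

text \<open>The parameter also enters the first row: for \<open>z \<noteq> 0\<close> this is conjugate to a companion matrix,
  and at \<open>z = 0\<close> it degenerates to the nilpotent matrix of rank one instead of the regular
  nilpotent one.\<close>

definition companion_curve :: "complex \<Rightarrow> complex \<Rightarrow> complex \<Rightarrow> complex \<Rightarrow> complex ^ 3 ^ 3" where
  "companion_curve s1 s2 s3 z =
     vector [vector [0, z, 0], vector [0, 0, 1], vector [s3 * z, - s2 * z, s1 * z]]"

text \<open>The characteristic polynomial is \<open>\<mu>\<^sup>3 - s1 z \<mu>\<^sup>2 + s2 z \<mu> - s3 z\<^sup>2\<close>; where \<open>\<bar>\<mu>\<bar> \<ge> 1\<close> its leading term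
  dominates the three others.\<close>

lemma companion_curve_in_spectral_unit_ball:
  assumes "cmod (s1 * z) < 1/3" "cmod (s2 * z) < 1/3" "cmod (s3 * z\<^sup>2) < 1/3"
  shows "companion_curve s1 s2 s3 z \<in> spectral_unit_ball"
proof -
  have "cmod \<mu> < 1" if v: "v \<noteq> 0" "companion_curve s1 s2 s3 z *v v = \<mu> *s v" for \<mu> v
  proof -
    note row = arg_cong[OF v(2), of "\<lambda>w. w $ i" for i]
    have e1: "z * v$2 = \<mu> * v$1"
      using row[of 1] by (simp add: matrix_vector_mult_def sum_3 companion_curve_def)
    have e2: "v$3 = \<mu> * v$2"
      using row[of 2] by (simp add: matrix_vector_mult_def sum_3 companion_curve_def)
    have e3: "s3 * z * v$1 - s2 * z * v$2 + s1 * z * v$3 = \<mu> * v$3"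
      using row[of 3] by (simp add: matrix_vector_mult_def sum_3 companion_curve_def)
    have "(\<mu>^3 - (s1 * z * \<mu>\<^sup>2 - s2 * z * \<mu> + s3 * z\<^sup>2)) * v$2 = 0"
      using e1 e2 e3 by algebra
    then consider "v$2 = 0" | "\<mu>^3 = s1 * z * \<mu>\<^sup>2 - s2 * z * \<mu> + s3 * z\<^sup>2" by auto
    then show ?thesis
    proof cases
      case 1
      then have "v$1 \<noteq> 0" using v(1) e2 by (auto simp: vec_eq_iff forall_3)
      then show ?thesis using e1 1 by auto
    next
      case 2
      show ?thesis
      proof (rule ccontr)
        assume "\<not> cmod \<mu> < 1"
        then have ge: "1 \<le> cmod \<mu>" by simp
        then have le: "cmod \<mu> \<le> cmod \<mu> ^ 2" "1 \<le> cmod \<mu> ^ 2" "cmod \<mu> ^ 2 \<le> cmod \<mu> ^ 3"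
          using power_increasing[of 1 2 "cmod \<mu>"] power_increasing[of 2 3 "cmod \<mu>"] by auto
        have "cmod \<mu> ^ 3 \<le> cmod (s1 * z) * cmod \<mu> ^ 2 + cmod (s2 * z) * cmod \<mu> + cmod (s3 * z\<^sup>2)"
        proof -
          have "cmod \<mu> ^ 3 = cmod (s1 * z * \<mu>\<^sup>2 - s2 * z * \<mu> + s3 * z\<^sup>2)"
            using 2 by (metis norm_power)
          also have "\<dots> \<le> cmod (s1 * z * \<mu>\<^sup>2) + cmod (s2 * z * \<mu>) + cmod (s3 * z\<^sup>2)"
            by (meson norm_triangle_ineq norm_triangle_ineq4 add_mono order_trans order_refl)
          finally show ?thesis by (simp add: norm_mult norm_power)
        qed
        also have "\<dots> \<le> 1/3 * cmod \<mu> ^ 2 + 1/3 * cmod \<mu> ^ 2 + cmod (s3 * z\<^sup>2)"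
          using assms le by (intro add_mono mult_mono) auto
        also have "\<dots> < 1/3 * cmod \<mu> ^ 2 + 1/3 * cmod \<mu> ^ 2 + 1/3 * cmod \<mu> ^ 2"
          using assms(3) le by simp
        finally show False using le by simp
      qed
    qed
  qed
  then show ?thesis unfolding spectral_unit_ball_def by auto
qed

lemma cayley_hamilton_row_3:
  fixes M :: "complex ^ 3 ^ 3"
  shows "((v v* M) v* M) v* M =
    det M *s v - second_minor_sum M *s (v v* M) + trace M *s ((v v* M) v* M)"
  unfolding vec_eq_iff forall_3 second_minor_sum_def
  by (simp add: vector_matrix_mult_def sum_3 det_3 trace_def; intro conjI; algebra)

text \<open>The rows span the Krylov space of \<open>v\<close>; \<open>v\<close> is a cyclic row vector of \<open>M\<close> exactly if this matrix
  is invertible, and then it conjugates \<open>M\<close> into companion form.\<close>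

definition krylov_matrix :: "complex ^ 3 \<Rightarrow> complex ^ 3 ^ 3 \<Rightarrow> complex ^ 3 ^ 3" where
  "krylov_matrix v M = vector [v, v v* M, (v v* M) v* M]"

lemma krylov_matrix_intertwines:
  "krylov_matrix v M ** M =
     companion_curve (trace M) (second_minor_sum M) (det M) 1 ** krylov_matrix v M"
proof -
  have row: "(X ** Y) $ i = X $ i v* Y" for X Y :: "complex ^ 3 ^ 3" and i
    by (simp add: vec_eq_iff matrix_matrix_mult_def vector_matrix_mult_def mult.commute)
  have "krylov_matrix v M $ i v* M =
     companion_curve (trace M) (second_minor_sum M) (det M) 1 $ i v* krylov_matrix v M" for i
    using exhaust_3[of i] cayley_hamilton_row_3[of v M]
    by (auto simp: krylov_matrix_def companion_curve_def)
       (simp_all add: vector_matrix_mult_def sum_3 vec_eq_iff)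
  then show ?thesis by (simp add: vec_eq_iff[of "_ ** _"] row)
qed

text \<open>Conjugation by an entire curve from the identity to the Krylov matrix does not change spectra
  and fixes the value of the companion curve at \<open>0\<close>, while it moves the value at \<open>1\<close> to \<open>M\<close>. The
  resulting curve is rescaled so that it passes through \<open>M\<close> at \<open>\<alpha>\<close>; on the unit disc its parameter is
  bounded by \<open>1/\<bar>\<alpha>\<bar>\<close>, which is what the bounds on the invariants of \<open>M\<close> compensate.\<close>

lemma lempert_le_of_krylov_joined:
  fixes M A :: "complex ^ 3 ^ 3"
  assumes A: "A = vector [vector [0, 0, 0], vector [0, 0, 1], vector [0, 0, 0]]"
    and joined: "joined_to_identity (krylov_matrix v M)"
    and \<alpha>: "\<alpha> \<noteq> 0" "cmod \<alpha> < 1"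
    and s1: "cmod (trace M) \<le> cmod \<alpha> / 3"
    and s2: "cmod (second_minor_sum M) \<le> cmod \<alpha> / 3"
    and s3: "cmod (det M) \<le> (cmod \<alpha>)\<^sup>2 / 3"
  shows "lempert (vec_of_matrix ` spectral_unit_ball) (vec_of_matrix A) (vec_of_matrix M)
           \<le> ereal (cmod \<alpha>)"
proof -
  let ?F = "companion_curve (trace M) (second_minor_sum M) (det M)"
  obtain R S where R: "entire_matrix R" and S: "entire_matrix S"
    and SR: "\<And>z. S z ** R z = mat 1" and R0: "R 0 = mat 1" and R1: "R 1 = krylov_matrix v M"
    using joined unfolding joined_to_identity_def by blast
  define \<Phi> where "\<Phi> z = S z ** ?F z ** R z" for z
  have "entire_matrix ?F"
    unfolding entire_matrix_def forall_3 companion_curve_def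
    by (auto intro!: holomorphic_intros)
  then have \<Phi>: "entire_matrix \<Phi>"
    unfolding \<Phi>_def by (intro entire_matrix_mult R S)
  have S0: "S 0 = mat 1" using SR[of 0] R0 by simp
  have \<Phi>0: "\<Phi> 0 = A"
    by (simp add: \<Phi>_def R0 S0 A companion_curve_def)
  have \<Phi>1: "\<Phi> 1 = M"
    using SR[of 1] krylov_matrix_intertwines[of v M, symmetric]
    by (simp add: \<Phi>_def R1 matrix_mul_assoc[symmetric])
       (simp add: matrix_mul_assoc)
  define \<phi> where "\<phi> \<zeta> = vec_of_matrix (\<Phi> (\<zeta> / \<alpha>))" for \<zeta>
  have "\<phi> \<in> holomorphic_discs (vec_of_matrix ` spectral_unit_ball)"
    unfolding holomorphic_discs_def
  proof (intro CollectI conjI allI)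
    fix p :: "3 \<times> 3"
    have "(\<lambda>z. \<Phi> z $ fst p $ snd p) \<circ> (\<lambda>\<zeta>. \<zeta> / \<alpha>) holomorphic_on ball 0 1"
      using \<Phi> \<alpha> unfolding entire_matrix_def
      by (intro holomorphic_on_compose_gen[where t = UNIV]) (auto intro!: holomorphic_intros)
    then show "(\<lambda>\<zeta>. \<phi> \<zeta> $ p) holomorphic_on ball 0 1"
      by (simp add: \<phi>_def vec_of_matrix_def o_def)
  next
    show "\<phi> ` ball 0 1 \<subseteq> vec_of_matrix ` spectral_unit_ball"
    proof (intro image_subsetI)
      fix \<zeta> :: complex assume "\<zeta> \<in> ball 0 1"
      then have \<zeta>: "cmod \<zeta> < 1" by simp
      have small: "cmod (s * (\<zeta> / \<alpha>) ^ n) < 1/3" if "cmod s \<le> cmod \<alpha> ^ n / 3" "n > 0" for s n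
      proof -
        have "cmod (s * (\<zeta> / \<alpha>) ^ n) = cmod s / cmod \<alpha> ^ n * cmod \<zeta> ^ n"
          by (simp add: norm_mult norm_divide norm_power power_divide)
        also have "\<dots> \<le> 1/3 * cmod \<zeta> ^ n"
          using that \<alpha> by (intro mult_right_mono) (auto simp: field_simps)
        also have "\<dots> < 1/3"
          using \<zeta> that(2) by (simp add: power_less_one_iff)
        finally show ?thesis .
      qed
      have "?F (\<zeta> / \<alpha>) \<in> spectral_unit_ball"
        using small[of _ 1] small[of _ 2] s1 s2 s3
        by (intro companion_curve_in_spectral_unit_ball) auto
      then have "\<Phi> (\<zeta> / \<alpha>) \<in> spectral_unit_ball"
        unfolding \<Phi>_def by (rule spectral_unit_ball_similar[OF _ SR])
      then show "\<phi> \<zeta> \<in> vec_of_matrix ` spectral_unit_ball" by (simp add: \<phi>_def)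
    qed
  qed
  moreover have "\<phi> 0 = vec_of_matrix A" "\<phi> \<alpha> = vec_of_matrix M"
    using \<alpha> by (simp_all add: \<phi>_def \<Phi>0 \<Phi>1)
  ultimately show ?thesis
    unfolding lempert_def using \<alpha> by (intro Inf_lower) auto
qed

section \<open>Cyclic row vectors of the perturbed matrices\<close>

text \<open>The rows of the identity can be exchanged for those of \<open>Q\<close> from top to bottom: the determinants
  of the intermediate matrices are the leading principal minors of \<open>Q\<close>.\<close>

lemma joined_to_identity_leading_minors:
  fixes Q :: "complex ^ 3 ^ 3"
  assumes "Q$1$1 \<noteq> 0" "Q$1$1 * Q$2$2 - Q$1$2 * Q$2$1 \<noteq> 0" "det Q \<noteq> 0"
  shows "joined_to_identity Q"
proof -
  define Q1 Q2 :: "complex ^ 3 ^ 3" where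
    "Q1 = vector [Q$1, vector [0, 1, 0], vector [0, 0, 1]]" and
    "Q2 = vector [Q$1, Q$2, vector [0, 0, 1]]"
  have "joined_to_identity Q1"
  proof (rule joined_to_identity_replace_row[OF joined_to_identity_mat_1, of 1])
    show "Q1 $ k = mat 1 $ k" if "k \<noteq> 1" for k
      using that exhaust_3[of k] by (auto simp: Q1_def vec_eq_iff forall_3 mat_def)
    show "det Q1 \<noteq> 0" using assms(1) by (simp add: det_3 Q1_def)
  qed
  then have "joined_to_identity Q2"
  proof (rule joined_to_identity_replace_row[of _ 2])
    show "Q2 $ k = Q1 $ k" if "k \<noteq> 2" for k
      using that exhaust_3[of k] by (auto simp: Q1_def Q2_def)
    show "det Q2 \<noteq> 0" using assms(2) by (simp add: det_3 Q2_def)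
  qed
  then show ?thesis
  proof (rule joined_to_identity_replace_row[of _ 3])
    show "Q $ k = Q2 $ k" if "k \<noteq> 3" for k
      using that exhaust_3[of k] by (auto simp: Q2_def)
  qed (fact assms(3))
qed

text \<open>The coefficient of \<open>x\<^sup>2\<close> in the Krylov determinant of the row vector \<open>(1, x, 0)\<close>, expanded by
  multilinearity in the rows.\<close>

definition krylov_x2_coeff :: "complex ^ 3 ^ 3 \<Rightarrow> complex" where
  "krylov_x2_coeff M =
     (let a = vector [1, 0, 0]; b = vector [0, 1, 0] in
        det (vector [a, b v* M, (b v* M) v* M] :: complex ^ 3 ^ 3) +
        det (vector [b, a v* M, (b v* M) v* M] :: complex ^ 3 ^ 3) +
        det (vector [b, b v* M, (a v* M) v* M] :: complex ^ 3 ^ 3))"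

lemma det_krylov_matrix_cubic:
  "\<exists>d0 d1 d3. \<forall>x. det (krylov_matrix (vector [1, x, 0]) M) =
     d0 + d1 * x + krylov_x2_coeff M * x\<^sup>2 + d3 * x ^ 3"
proof -
  define a b :: "complex ^ 3" where "a = vector [1, 0, 0]" and "b = vector [0, 1, 0]"
  have lin: "(p + x *s q) v* M = p v* M + x *s (q v* M)" for p q x
    by (simp add: vec_eq_iff vector_matrix_mult_def sum.distrib sum_distrib_left algebra_simps)
  have v: "vector [1, x, 0] = a + x *s b" for x
    by (simp add: vec_eq_iff forall_3 a_def b_def)
  have multilinear:
    "det (vector [a + x *s b, a1 + x *s b1, a2 + x *s b2] :: complex ^ 3 ^ 3) =
       det (vector [a, a1, a2] :: complex ^ 3 ^ 3)
       + (det (vector [b, a1, a2] :: complex ^ 3 ^ 3) + det (vector [a, b1, a2] :: complex ^ 3 ^ 3)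
          + det (vector [a, a1, b2] :: complex ^ 3 ^ 3)) * x
       + (det (vector [a, b1, b2] :: complex ^ 3 ^ 3) + det (vector [b, a1, b2] :: complex ^ 3 ^ 3)
          + det (vector [b, b1, a2] :: complex ^ 3 ^ 3)) * x\<^sup>2
       + det (vector [b, b1, b2] :: complex ^ 3 ^ 3) * x ^ 3" for x a1 b1 a2 b2
    by (simp add: det_3) algebra
  have "\<forall>x. det (krylov_matrix (vector [1, x, 0]) M) =
      det (vector [a, a v* M, (a v* M) v* M] :: complex ^ 3 ^ 3)
       + (det (vector [b, a v* M, (a v* M) v* M] :: complex ^ 3 ^ 3)
          + det (vector [a, b v* M, (a v* M) v* M] :: complex ^ 3 ^ 3)
          + det (vector [a, a v* M, (b v* M) v* M] :: complex ^ 3 ^ 3)) * x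
       + krylov_x2_coeff M * x\<^sup>2
       + det (vector [b, b v* M, (b v* M) v* M] :: complex ^ 3 ^ 3) * x ^ 3"
    unfolding krylov_matrix_def v lin multilinear krylov_x2_coeff_def Let_def a_def[symmetric] b_def[symmetric]
    by simp
  then show ?thesis by blast
qed

text \<open>Averaging the cubic polynomial over the fourth roots of unity with weights \<open>x\<^sup>-\<^sup>2\<close> extracts its
  quadratic coefficient. Working with \<open>x \<noteq> 0\<close> matters later: at \<open>x = 0\<close> the second leading minor of
  the Krylov matrix may vanish.\<close>

lemma ex_det_krylov_matrix_nonzero:
  assumes "krylov_x2_coeff M \<noteq> 0"
  shows "\<exists>x\<in>{1, -1, \<i>, -\<i>}. det (krylov_matrix (vector [1, x, 0]) M) \<noteq> 0"
proof (rule ccontr)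
  assume "\<not> ?thesis"
  moreover obtain d0 d1 d3 where
    d: "\<And>x. det (krylov_matrix (vector [1, x, 0]) M) =
          d0 + d1 * x + krylov_x2_coeff M * x\<^sup>2 + d3 * x ^ 3"
    using det_krylov_matrix_cubic[of M] by blast
  ultimately have
    "d0 + d1 + krylov_x2_coeff M + d3 = 0" "d0 - d1 + krylov_x2_coeff M - d3 = 0"
    "d0 + d1 * \<i> - krylov_x2_coeff M - d3 * \<i> = 0"
    "d0 - d1 * \<i> - krylov_x2_coeff M + d3 * \<i> = 0"
    using d[of 1] d[of "-1"] d[of \<i>] d[of "-\<i>"]
    by (simp_all add: power3_eq_cube)
  then have "4 * krylov_x2_coeff M = 0" by algebra
  then show False using assms by simp
qed

text \<open>The coefficient for \<open>M = A + t C\<close> without its term in the entry \<open>(3, 2)\<close> of \<open>C\<close>, divided by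
  \<open>t\<^sup>2\<close>. At \<open>t = 0\<close> and \<open>C = B\<close> its value is \<open>3\<close>. Here \<open>m\<close> is the entry \<open>(2, 3)\<close> of \<open>M\<close>, and
  \<open>r\<close> is the entry \<open>(2, 3)\<close> of \<open>M\<^sup>2\<close> divided by \<open>t\<close>.\<close>

definition krylov_x2_main_part :: "complex \<Rightarrow> complex ^ 3 ^ 3 \<Rightarrow> complex" where
  "krylov_x2_main_part t C =
     (let m = 1 + t * C$2$3; r = t * C$2$1 * C$1$3 + C$2$2 * m + m * C$3$3 in
        C$2$2 * r - m * (C$2$1 * C$1$2 + (C$2$2)\<^sup>2)
        - (C$1$1 * r - C$1$3 * (t * (C$2$1 * C$1$1 + C$2$2 * C$2$1) + m * C$3$1))
        - (C$2$1 * (t * C$1$1 * C$1$3 + C$1$2 * m + t * C$1$3 * C$3$3)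
           - m * ((C$1$1)\<^sup>2 + C$1$2 * C$2$1 + C$1$3 * C$3$1)))"

text \<open>The entry \<open>(3, 2)\<close> of \<open>C\<close> is the only one that contributes to first order in \<open>t\<close>: its
  companions are two factors \<open>1 + t C\<^sub>2\<^sub>3\<close>, one from the entry \<open>(2, 2)\<close> of \<open>M\<^sup>2\<close> and one from the
  determinant, whereas every other term has at least two factors of order \<open>t\<close>.\<close>

lemma krylov_x2_coeff_perturbed:
  fixes A C M :: "complex ^ 3 ^ 3"
  assumes A: "A = vector [vector [0, 0, 0], vector [0, 0, 1], vector [0, 0, 0]]"
    and M: "\<And>i j. M$i$j = A$i$j + t * C$i$j"
  shows "krylov_x2_coeff M =
    t\<^sup>2 * krylov_x2_main_part t C - t * C$3$2 * (1 + t * C$2$3)\<^sup>2"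
  unfolding krylov_x2_coeff_def krylov_x2_main_part_def Let_def
  by (simp add: det_3 vector_matrix_mult_def sum_3 M A) algebra

section \<open>The Lempert function near the nilpotent matrix\<close>

lemma lempert_nonneg: "0 \<le> lempert D z w"
  unfolding lempert_def by (rule Inf_greatest) auto

text \<open>For every \<open>e > 0\<close> the point \<open>\<alpha> = e t\<close> is eventually admissible: the trace and the second
  invariant of \<open>M\<close> are \<open>o(t)\<close>, the determinant is \<open>o(t\<^sup>2)\<close>, and one of four vectors \<open>(1, x, 0)\<close> is
  cyclic.\<close>

lemma lempert_quotient_tendsto_0:
  fixes A B :: "complex ^ 3 ^ 3" and t :: "nat \<Rightarrow> complex" and C :: "nat \<Rightarrow> complex ^ 3 ^ 3"
  assumes \<omega>: "1 + \<omega> + \<omega>\<^sup>2 = 0"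
    and A: "A = vector [vector [0, 0, 0], vector [0, 0, 1], vector [0, 0, 0]]"
    and B: "B = vector [vector [1, 0, 0], vector [0, \<omega>, 0], vector [0, 0, \<omega>\<^sup>2]]"
    and t: "\<And>j. t j \<noteq> 0" "t \<longlonglongrightarrow> 0"
    and C: "C \<longlonglongrightarrow> B"
    and lower: "liminf (\<lambda>j. ereal (cmod (C j $ 3 $ 2 / t j - 3))) > 0"
  shows "(\<lambda>j. lempert (vec_of_matrix ` spectral_unit_ball) (vec_of_matrix A)
            (vec_of_matrix A + t j *s vec_of_matrix (C j)) / ereal (cmod (t j))) \<longlonglongrightarrow> 0"
proof -
  define M where "M j = (\<chi> k l. A$k$l + t j * C j$k$l)" for j
  have M: "M j $ k $ l = A$k$l + t j * C j$k$l" for j k l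
    by (simp add: M_def)
  have vec_M: "vec_of_matrix A + t j *s vec_of_matrix (C j) = vec_of_matrix (M j)" for j
    by (simp add: vec_eq_iff vec_of_matrix_def M)
  have \<omega>3: "\<omega> ^ 3 = 1" using \<omega> by algebra
  have \<omega>1: "\<omega> \<noteq> 1" using \<omega> by auto
  have lim: "(\<lambda>j. C j $ k $ l) \<longlonglongrightarrow> B $ k $ l" for k l
    by (intro tendsto_vec_nth C)
  note lims = lim[of 1 1] lim[of 1 2] lim[of 1 3] lim[of 2 1] lim[of 2 2] lim[of 2 3]
    lim[of 3 1] lim[of 3 2] lim[of 3 3]
  note lims' = lims[unfolded B, simplified]
  have cyclic: "\<forall>\<^sub>F j in sequentially. krylov_x2_coeff (M j) \<noteq> 0"
  proof -
    obtain e where "0 < ereal e" and e: "ereal e < liminf (\<lambda>j. ereal (cmod (C j $ 3 $ 2 / t j - 3)))"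
      using ereal_dense2[OF lower] by blast
    then have "e > 0" by simp
    have away: "\<forall>\<^sub>F j in sequentially. cmod (C j $ 3 $ 2 / t j - 3) > e"
      using less_LiminfD[OF e] by simp
    have m: "(\<lambda>j. 1 + t j * C j $ 2 $ 3) \<longlonglongrightarrow> 1"
      by (rule tendsto_eq_rhs, (rule tendsto_intros lims' t)+) simp
    have "(\<lambda>j. krylov_x2_main_part (t j) (C j)) \<longlonglongrightarrow> 3"
      unfolding krylov_x2_main_part_def Let_def
      by (rule tendsto_eq_rhs, (rule tendsto_intros lims' t)+, use \<omega> \<omega>3 in simp, algebra)
    then have "(\<lambda>j. krylov_x2_main_part (t j) (C j) / (1 + t j * C j $ 2 $ 3)\<^sup>2) \<longlonglongrightarrow> 3 / 1\<^sup>2"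
      by (intro tendsto_intros m) auto
    then have near: "\<forall>\<^sub>F j in sequentially.
        cmod (krylov_x2_main_part (t j) (C j) / (1 + t j * C j $ 2 $ 3)\<^sup>2 - 3) < e"
      using \<open>e > 0\<close> by (auto simp: tendsto_iff dist_norm)
    have "\<forall>\<^sub>F j in sequentially. 1 + t j * C j $ 2 $ 3 \<noteq> 0"
      by (rule tendsto_imp_eventually_ne[OF m]) simp
    then show ?thesis
      using away near
    proof eventually_elim
      case (elim j)
      show ?case
      proof
        \<comment> \<open>A zero coefficient would make \<open>C\<^sub>3\<^sub>2/t\<close> equal to a quantity that tends to \<open>3\<close>.\<close>
        assume "krylov_x2_coeff (M j) = 0"
        then have "t j * (t j * krylov_x2_main_part (t j) (C j)) = t j * (C j $ 3 $ 2 * (1 + t j * C j $ 2 $ 3)\<^sup>2)"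
          using krylov_x2_coeff_perturbed[OF A M, of j] by (simp add: power2_eq_square algebra_simps)
        then have "t j * krylov_x2_main_part (t j) (C j) = C j $ 3 $ 2 * (1 + t j * C j $ 2 $ 3)\<^sup>2"
          using t(1)[of j] by simp
        then have "krylov_x2_main_part (t j) (C j) / (1 + t j * C j $ 2 $ 3)\<^sup>2 = C j $ 3 $ 2 / t j"
          using t(1)[of j] elim(1) by (simp add: divide_eq_eq eq_divide_eq mult.commute)
        then show False using elim(2,3) by simp
      qed
    qed
  qed
  have minors: "\<forall>\<^sub>F j in sequentially. \<forall>x\<in>{1, -1, \<i>, -\<i>}.
      (vector [1, x, 0] v* M j) $ 2 - x * (vector [1, x, 0] v* M j) $ 1 \<noteq> 0"
  proof (intro eventually_ball_finite ballI)
    fix x :: complex assume x: "x \<in> {1, -1, \<i>, -\<i>}"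
    have "(\<lambda>j. (C j $ 1 $ 2 + x * C j $ 2 $ 2) - x * (C j $ 1 $ 1 + x * C j $ 2 $ 1))
        \<longlonglongrightarrow> (0 + x * \<omega>) - x * (1 + x * 0)"
      by (intro tendsto_intros lims')
    moreover have "(0 + x * \<omega>) - x * (1 + x * 0) \<noteq> 0"
      using x \<omega>1 by auto
    ultimately have "\<forall>\<^sub>F j in sequentially.
        (C j $ 1 $ 2 + x * C j $ 2 $ 2) - x * (C j $ 1 $ 1 + x * C j $ 2 $ 1) \<noteq> 0"
      by (rule tendsto_imp_eventually_ne)
    then show "\<forall>\<^sub>F j in sequentially.
        (vector [1, x, 0] v* M j) $ 2 - x * (vector [1, x, 0] v* M j) $ 1 \<noteq> 0"
    proof eventually_elim
      case (elim j)
      have "(vector [1, x, 0] v* M j) $ 2 - x * (vector [1, x, 0] v* M j) $ 1 =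
          t j * ((C j $ 1 $ 2 + x * C j $ 2 $ 2) - x * (C j $ 1 $ 1 + x * C j $ 2 $ 1))"
        by (simp add: vector_matrix_mult_def sum_3 M A algebra_simps)
      then show ?case using elim t(1)[of j] by simp
    qed
  qed simp
  have trace_M: "trace (M j) = t j * (C j$1$1 + C j$2$2 + C j$3$3)" for j
    by (simp add: trace_def sum_3 M A algebra_simps)
  have trace_lim: "(\<lambda>j. C j$1$1 + C j$2$2 + C j$3$3) \<longlonglongrightarrow> 0"
    by (rule tendsto_eq_rhs, (rule tendsto_intros lims' t)+, use \<omega> in simp)
  define q where "q j = t j * (C j$1$1 * C j$2$2 - C j$1$2 * C j$2$1
      + (C j$1$1 * C j$3$3 - C j$1$3 * C j$3$1) + C j$2$2 * C j$3$3)
      - (1 + t j * C j$2$3) * C j$3$2" for j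
  have second_M: "second_minor_sum (M j) = t j * q j" for j
    by (simp add: second_minor_sum_def q_def M A algebra_simps)
  have q_lim: "q \<longlonglongrightarrow> 0"
    unfolding q_def by (rule tendsto_eq_rhs, (rule tendsto_intros lims' t)+) simp
  define d where "d j = C j$1$1 * (t j * C j$2$2 * C j$3$3 - (1 + t j * C j$2$3) * C j$3$2)
      - C j$1$2 * (t j * C j$2$1 * C j$3$3 - (1 + t j * C j$2$3) * C j$3$1)
      + C j$1$3 * t j * (C j$2$1 * C j$3$2 - C j$2$2 * C j$3$1)" for j
  have det_M: "det (M j) = (t j)\<^sup>2 * d j" for j
    by (simp add: det_3 d_def M A power2_eq_square algebra_simps)
  have d_lim: "d \<longlonglongrightarrow> 0"
    unfolding d_def by (rule tendsto_eq_rhs, (rule tendsto_intros lims' t)+) simp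
  have bound: "\<forall>\<^sub>F j in sequentially.
      lempert (vec_of_matrix ` spectral_unit_ball) (vec_of_matrix A) (vec_of_matrix (M j))
        \<le> ereal (e * cmod (t j))" if "e > 0" for e
  proof -
    have small: "\<forall>\<^sub>F j in sequentially. cmod (f j) < c" if "f \<longlonglongrightarrow> 0" "c > 0" for f :: "nat \<Rightarrow> complex" and c
      using that by (auto simp: tendsto_iff dist_norm)
    have "\<forall>\<^sub>F j in sequentially. cmod (t j) < 1 / e"
      "\<forall>\<^sub>F j in sequentially. cmod (C j$1$1 + C j$2$2 + C j$3$3) < e / 3"
      "\<forall>\<^sub>F j in sequentially. cmod (q j) < e / 3"
      "\<forall>\<^sub>F j in sequentially. cmod (d j) < e\<^sup>2 / 3"
      using \<open>e > 0\<close> by (intro small t trace_lim q_lim d_lim; simp)+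
    with cyclic minors show ?thesis
    proof eventually_elim
      case (elim j)
      obtain x where x: "x \<in> {1, -1, \<i>, -\<i>}"
        and det: "det (krylov_matrix (vector [1, x, 0]) (M j)) \<noteq> 0"
        using ex_det_krylov_matrix_nonzero[OF elim(1)] by blast
      have joined: "joined_to_identity (krylov_matrix (vector [1, x, 0]) (M j))"
        using elim(2) x det
        by (intro joined_to_identity_leading_minors) (auto simp: krylov_matrix_def)
      let ?\<alpha> = "of_real e * t j"
      have \<alpha>: "cmod ?\<alpha> = e * cmod (t j)" using \<open>e > 0\<close> by (simp add: norm_mult)
      have "lempert (vec_of_matrix ` spectral_unit_ball) (vec_of_matrix A) (vec_of_matrix (M j))
          \<le> ereal (cmod ?\<alpha>)"
      proof (rule lempert_le_of_krylov_joined[OF A joined])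
        show "?\<alpha> \<noteq> 0" using \<open>e > 0\<close> t(1) by simp
        show "cmod ?\<alpha> < 1"
          unfolding \<alpha> using elim(3) \<open>e > 0\<close> by (simp add: field_simps)
        show "cmod (trace (M j)) \<le> cmod ?\<alpha> / 3"
          unfolding \<alpha> unfolding trace_M norm_mult
          using mult_left_mono[OF less_imp_le[OF elim(4)], of "cmod (t j)"] by (simp add: mult.commute)
        show "cmod (second_minor_sum (M j)) \<le> cmod ?\<alpha> / 3"
          unfolding \<alpha> unfolding second_M norm_mult
          using mult_left_mono[OF less_imp_le[OF elim(5)], of "cmod (t j)"] by (simp add: mult.commute)
        show "cmod (det (M j)) \<le> (cmod ?\<alpha>)\<^sup>2 / 3"
          unfolding \<alpha> unfolding det_M norm_mult norm_power
          using mult_left_mono[OF less_imp_le[OF elim(6)], of "(cmod (t j))\<^sup>2"]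
          by (simp add: mult.commute power_mult_distrib)
      qed
      then show ?case unfolding \<alpha> .
    qed
  qed
  show ?thesis
    unfolding vec_M
  proof (rule order_tendstoI)
    fix a :: ereal assume a: "a < 0"
    have "0 \<le> lempert (vec_of_matrix ` spectral_unit_ball) (vec_of_matrix A)
        (vec_of_matrix (M j)) / ereal (cmod (t j))" for j
      using t(1)[of j] lempert_nonneg by (simp add: ereal_le_divide_pos)
    then show "\<forall>\<^sub>F j in sequentially. a < lempert (vec_of_matrix ` spectral_unit_ball)
        (vec_of_matrix A) (vec_of_matrix (M j)) / ereal (cmod (t j))"
      by (intro always_eventually allI less_le_trans[OF a])
  next
    fix a :: ereal assume "0 < a"
    then obtain e where e: "0 < ereal e" "ereal e < a" using ereal_dense2 by blast
    then have "e > 0" by simp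
    from bound[OF this]
    show "\<forall>\<^sub>F j in sequentially. lempert (vec_of_matrix ` spectral_unit_ball)
        (vec_of_matrix A) (vec_of_matrix (M j)) / ereal (cmod (t j)) < a"
    proof eventually_elim
      case (elim j)
      then have "lempert (vec_of_matrix ` spectral_unit_ball)
          (vec_of_matrix A) (vec_of_matrix (M j)) / ereal (cmod (t j)) \<le> ereal e"
        using t(1)[of j] by (simp add: ereal_divide_le_pos mult.commute)
      then show ?case using e(2) by (rule le_less_trans)
    qed
  qed
qed

section \<open>Positivity of the Kobayashi-Royden pseudometric\<close>

text \<open>The two numbers are elementary symmetric functions of the eigenvalues.\<close>

lemma spectral_unit_ball_3_coefficient_bounds:
  fixes M :: "complex ^ 3 ^ 3"
  assumes "M \<in> spectral_unit_ball"
  shows "cmod (second_minor_sum M) \<le> 3" and "cmod (det M) \<le> 1"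
proof -
  define p where "p = [:- det M, second_minor_sum M, - trace M, 1:]"
  have root: "cmod \<mu> \<le> 1" if "poly p \<mu> = 0" for \<mu>
  proof -
    have "det (M - mat \<mu>) = - poly p \<mu>"
      by (simp add: p_def det_3 trace_def sum_3 second_minor_sum_def mat_def algebra_simps)
    then have "\<not> invertible (M - mat \<mu>)" using that by (simp add: invertible_det_nz)
    then obtain v where "v \<noteq> 0" "(M - mat \<mu>) *v v = 0"
      unfolding invertible_left_inverse matrix_left_invertible_ker by blast
    moreover have "mat \<mu> *v v = \<mu> *s v" for v :: "complex ^ 3"
      by (simp add: vec_eq_iff forall_3 matrix_vector_mult_def sum_3 mat_def)
    ultimately have "M *v v = \<mu> *s v" "v \<noteq> 0"
      by (simp_all add: matrix_vector_mult_diff_rdistrib)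
    then show ?thesis using assms unfolding spectral_unit_ball_def by force
  qed
  have "p \<noteq> 0" "degree p = 3" "lead_coeff p = 1" by (simp_all add: p_def)
  then obtain R where size: "size R = 3" and fact: "p = (\<Prod>x\<in>#R. [:- x, 1:])"
    using alg_closed_imp_factorization[of p] by auto
  obtain a R1 where R1: "R = add_mset a R1" "size R1 = 2"
    using size size_eq_Suc_imp_eq_union[of R 2] by auto
  obtain b R2 where R2: "R1 = add_mset b R2" "size R2 = 1"
    using R1(2) size_eq_Suc_imp_eq_union[of R1 1] by auto
  obtain c where "R2 = {#c#}"
    using R2(2) size_1_singleton_mset by blast
  then have R: "R = {#a, b, c#}" by (simp add: R1 R2)
  have p: "p = [:- a, 1:] * [:- b, 1:] * [:- c, 1:]"
    by (simp only: fact R image_mset_add_mset image_mset_empty prod_mset.add_mset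
        prod_mset_empty mult.assoc mult_1_right)
  have abc: "cmod a \<le> 1" "cmod b \<le> 1" "cmod c \<le> 1"
    by (rule root; unfold p poly_mult; simp)+
  have "det M = a * b * c" and s2: "second_minor_sum M = a * b + a * c + b * c"
    using p by (simp_all add: p_def algebra_simps)
  then show "cmod (det M) \<le> 1"
    using abc by (simp add: norm_mult mult_le_one)
  have "cmod (second_minor_sum M) \<le> cmod (a * b) + cmod (a * c) + cmod (b * c)"
    unfolding s2 by (meson norm_triangle_ineq add_mono order_trans order_refl)
  also have "\<dots> \<le> 1 + 1 + 1"
    using abc by (intro add_mono) (simp_all add: norm_mult mult_le_one)
  finally show "cmod (second_minor_sum M) \<le> 3" by simp
qed

text \<open>A form of Cauchy's estimate for the lowest Taylor coefficient. It is taken on the circle of radius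
  \<open>1/2\<close>, which costs the factor \<open>2 ^ n\<close>.\<close>

lemma cmod_at_0_le_of_factor_bound:
  assumes "G holomorphic_on ball 0 1" and "\<And>\<zeta>. cmod \<zeta> < 1 \<Longrightarrow> cmod (\<zeta> ^ n * G \<zeta>) \<le> c"
  shows "cmod (G 0) \<le> 2 ^ n * c"
proof -
  have "cmod ((deriv ^^ 0) G 0) \<le> fact 0 * (2 ^ n * c) / (1/2) ^ 0"
  proof (rule Cauchy_inequality)
    show "G holomorphic_on ball 0 (1/2)"
      using assms(1) by (rule holomorphic_on_subset) auto
    show "continuous_on (cball 0 (1/2)) G"
      using holomorphic_on_imp_continuous_on[OF assms(1)] by (rule continuous_on_subset) auto
    fix \<zeta> :: complex assume "cmod (0 - \<zeta>) = 1/2"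
    then have "cmod \<zeta> = 1/2" by simp
    then show "cmod (G \<zeta>) \<le> 2 ^ n * c"
      using assms(2)[of \<zeta>] by (simp only: norm_mult norm_power power_divide) (simp add: field_simps)
  qed simp
  then show ?thesis by simp
qed

text \<open>The \<open>\<zeta>\<^sup>2\<close>-coefficient of the second invariant contains the sum of the products of two diagonal
  entries of \<open>\<phi>'(0)\<close>, which is zero since these are proportional to the three cube roots of unity.
  What is left is the second-order coefficient \<open>y\<close> of the entry \<open>(3, 2)\<close>, so \<open>y\<close> is bounded by a
  constant. In the determinant \<open>y\<close> competes with \<open>1/\<alpha>\<^sup>2\<close>, and a bounded \<open>y\<close> cannot cancel it for
  small \<open>\<alpha>\<close>. The constant \<open>1/4\<close> is not optimal.\<close>

lemma kobayashi_royden_ge: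
  fixes A B :: "complex ^ 3 ^ 3"
  assumes \<omega>: "1 + \<omega> + \<omega>\<^sup>2 = 0"
    and A: "A = vector [vector [0, 0, 0], vector [0, 0, 1], vector [0, 0, 0]]"
    and B: "B = vector [vector [1, 0, 0], vector [0, \<omega>, 0], vector [0, 0, \<omega>\<^sup>2]]"
  shows "ereal (1/4) \<le>
    kobayashi_royden (vec_of_matrix ` spectral_unit_ball) (vec_of_matrix A) (vec_of_matrix B)"
proof -
  have "1/4 \<le> cmod \<alpha>"
    if \<phi>: "\<phi> \<in> holomorphic_discs (vec_of_matrix ` spectral_unit_ball)"
      and \<phi>0: "\<phi> 0 = vec_of_matrix A"
      and \<phi>': "\<alpha> *s complex_derivative \<phi> 0 = vec_of_matrix B" for \<alpha> \<phi>
  proof -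
    define f where "f k l \<zeta> = \<phi> \<zeta> $ (k, l)" for k l \<zeta>
    have f0: "f k l 0 = A $ k $ l" for k l
      by (simp add: f_def \<phi>0 vec_of_matrix_def)
    have df: "\<alpha> * deriv (f k l) 0 = B $ k $ l" for k l
      using arg_cong[OF \<phi>', of "\<lambda>x. x $ (k, l)"]
      by (simp add: complex_derivative_def vec_of_matrix_def f_def[abs_def])
    have \<alpha>: "\<alpha> \<noteq> 0" using df[of 1 1] by (auto simp: B)
    have "\<exists>g. g holomorphic_on ball 0 1 \<and> g 0 = B $ k $ l / \<alpha> \<and>
        (\<forall>\<zeta>. cmod \<zeta> < 1 \<longrightarrow> f k l \<zeta> = A $ k $ l + \<zeta> * g \<zeta>)" for k l
    proof -
      have hol: "f k l holomorphic_on ball 0 1"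
        using \<phi> by (simp add: holomorphic_discs_def f_def[abs_def])
      then have "(\<lambda>\<zeta>. f k l \<zeta> - A $ k $ l) holomorphic_on ball 0 1"
        by (intro holomorphic_intros)
      then obtain g where g: "g holomorphic_on ball 0 1"
        "\<And>\<zeta>. cmod \<zeta> < 1 \<Longrightarrow> f k l \<zeta> - A $ k $ l = \<zeta> * g \<zeta>"
        "deriv (\<lambda>\<zeta>. f k l \<zeta> - A $ k $ l) 0 = g 0"
        by (rule Schwarz3) (auto simp: f0)
      have "f k l field_differentiable at 0"
        using hol by (rule holomorphic_on_imp_differentiable_at) auto
      then have "g 0 = deriv (f k l) 0"
        using g(3) by simp
      then have "g 0 = B $ k $ l / \<alpha>"
        using df[of k l] \<alpha> by (simp add: field_simps)
      then show ?thesis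
        using g(1,2) by (intro exI[of _ g]) (simp add: algebra_simps)
    qed
    then obtain g where g: "\<And>k l. g k l holomorphic_on ball 0 1"
      and g0: "\<And>k l. g k l 0 = B $ k $ l / \<alpha>"
      and fg: "\<And>k l \<zeta>. cmod \<zeta> < 1 \<Longrightarrow> f k l \<zeta> = A $ k $ l + \<zeta> * g k l \<zeta>"
      by metis
    \<comment> \<open>\<open>B\<close> is diagonal, so the other entries are constant up to second order.\<close>
    have "\<exists>h. h holomorphic_on ball 0 1 \<and> (\<forall>\<zeta>. cmod \<zeta> < 1 \<longrightarrow> g k l \<zeta> = \<zeta> * h \<zeta>)"
      if "k \<noteq> l" for k l
    proof -
      have "g k l 0 = 0"
        using that exhaust_3[of k] exhaust_3[of l] by (auto simp: g0 B)
      then show ?thesis using Schwarz3[OF g[of k l]] by metis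
    qed
    then obtain h where h: "\<And>k l. k \<noteq> l \<Longrightarrow> h k l holomorphic_on ball 0 1"
      and gh: "\<And>k l \<zeta>. k \<noteq> l \<Longrightarrow> cmod \<zeta> < 1 \<Longrightarrow> g k l \<zeta> = \<zeta> * h k l \<zeta>"
      by metis
    define F where "F \<zeta> = (\<chi> k l. f k l \<zeta>)" for \<zeta>
    have F: "F \<zeta> \<in> spectral_unit_ball" if "cmod \<zeta> < 1" for \<zeta>
    proof -
      have "\<phi> \<zeta> \<in> vec_of_matrix ` spectral_unit_ball"
        using \<phi> that unfolding holomorphic_discs_def by force
      then obtain N where "N \<in> spectral_unit_ball" "\<phi> \<zeta> = vec_of_matrix N" by blast
      moreover have "F \<zeta> = N"
        using calculation(2) by (simp add: F_def f_def vec_eq_iff vec_of_matrix_def)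
      ultimately show ?thesis by simp
    qed
    have Fij: "F \<zeta> $ 1 $ 1 = \<zeta> * g 1 1 \<zeta>" "F \<zeta> $ 1 $ 2 = \<zeta>\<^sup>2 * h 1 2 \<zeta>" "F \<zeta> $ 1 $ 3 = \<zeta>\<^sup>2 * h 1 3 \<zeta>"
      "F \<zeta> $ 2 $ 1 = \<zeta>\<^sup>2 * h 2 1 \<zeta>" "F \<zeta> $ 2 $ 2 = \<zeta> * g 2 2 \<zeta>" "F \<zeta> $ 2 $ 3 = 1 + \<zeta>\<^sup>2 * h 2 3 \<zeta>"
      "F \<zeta> $ 3 $ 1 = \<zeta>\<^sup>2 * h 3 1 \<zeta>" "F \<zeta> $ 3 $ 2 = \<zeta>\<^sup>2 * h 3 2 \<zeta>" "F \<zeta> $ 3 $ 3 = \<zeta> * g 3 3 \<zeta>"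
      if "cmod \<zeta> < 1" for \<zeta>
      using that by (simp_all add: F_def fg gh A power2_eq_square)
    \<comment> \<open>\<open>G2\<close> and \<open>G3\<close> are the invariants of \<open>F\<close> divided by \<open>\<zeta>\<^sup>2\<close> and \<open>\<zeta>\<^sup>3\<close>.\<close>
    define G2 where "G2 \<zeta> = g 1 1 \<zeta> * g 2 2 \<zeta> - \<zeta>\<^sup>2 * h 1 2 \<zeta> * h 2 1 \<zeta>
        + (g 1 1 \<zeta> * g 3 3 \<zeta> - \<zeta>\<^sup>2 * h 1 3 \<zeta> * h 3 1 \<zeta>)
        + (g 2 2 \<zeta> * g 3 3 \<zeta> - (1 + \<zeta>\<^sup>2 * h 2 3 \<zeta>) * h 3 2 \<zeta>)" for \<zeta>
    define G3 where "G3 \<zeta> = g 1 1 \<zeta> * (g 2 2 \<zeta> * g 3 3 \<zeta> - (1 + \<zeta>\<^sup>2 * h 2 3 \<zeta>) * h 3 2 \<zeta>)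
        - \<zeta> * h 1 2 \<zeta> * (\<zeta> * h 2 1 \<zeta> * g 3 3 \<zeta> - (1 + \<zeta>\<^sup>2 * h 2 3 \<zeta>) * h 3 1 \<zeta>)
        + \<zeta>\<^sup>2 * h 1 3 \<zeta> * (\<zeta> * h 2 1 \<zeta> * h 3 2 \<zeta> - g 2 2 \<zeta> * h 3 1 \<zeta>)" for \<zeta>
    have G2: "second_minor_sum (F \<zeta>) = \<zeta> ^ 2 * G2 \<zeta>" if "cmod \<zeta> < 1" for \<zeta>
      unfolding second_minor_sum_def Fij[OF that] G2_def by algebra
    have G3: "det (F \<zeta>) = \<zeta> ^ 3 * G3 \<zeta>" if "cmod \<zeta> < 1" for \<zeta>
      unfolding det_3 Fij[OF that] G3_def by algebra
    define y where "y = h 3 2 0"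
    have "cmod (G2 0) \<le> 2 ^ 2 * 3"
    proof (rule cmod_at_0_le_of_factor_bound)
      show "G2 holomorphic_on ball 0 1"
        unfolding G2_def by (intro holomorphic_intros g h) auto
      show "cmod (\<zeta> ^ 2 * G2 \<zeta>) \<le> 3" if "cmod \<zeta> < 1" for \<zeta>
        using spectral_unit_ball_3_coefficient_bounds(1)[OF F[OF that]] by (simp add: G2[OF that])
    qed
    moreover have "G2 0 = - y"
    proof -
      have "\<omega> + \<omega>\<^sup>2 + \<omega> * \<omega>\<^sup>2 = 0" using \<omega> by algebra
      then have "\<omega> / \<alpha>\<^sup>2 + \<omega>\<^sup>2 / \<alpha>\<^sup>2 + \<omega> * \<omega>\<^sup>2 / \<alpha>\<^sup>2 = 0"
        by (metis add_divide_distrib div_0)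
      then show ?thesis
        by (simp add: G2_def g0 B y_def power2_eq_square algebra_simps)
    qed
    ultimately have y: "cmod y \<le> 12" by simp
    have G3_bound: "cmod (G3 0) \<le> 2 ^ 3 * 1"
    proof (rule cmod_at_0_le_of_factor_bound)
      show "G3 holomorphic_on ball 0 1"
        unfolding G3_def by (intro holomorphic_intros g h) auto
      show "cmod (\<zeta> ^ 3 * G3 \<zeta>) \<le> 1" if "cmod \<zeta> < 1" for \<zeta>
        using spectral_unit_ball_3_coefficient_bounds(2)[OF F[OF that]] by (simp add: G3[OF that])
    qed
    have G3_0: "G3 0 = 1 / \<alpha> * (1 / \<alpha>\<^sup>2 - y)"
    proof -
      have "\<omega> * \<omega>\<^sup>2 = 1" using \<omega> by algebra
      then have "\<omega> / \<alpha> * (\<omega>\<^sup>2 / \<alpha>) = 1 / \<alpha>\<^sup>2" by (simp add: power2_eq_square)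
      then show ?thesis by (simp add: G3_def g0 B y_def)
    qed
    have prod: "cmod (1 / \<alpha>) * cmod (1 / \<alpha>\<^sup>2 - y) \<le> 8"
      using G3_bound unfolding G3_0 norm_mult by simp
    show "1/4 \<le> cmod \<alpha>"
    proof (rule ccontr)
      assume "\<not> 1/4 \<le> cmod \<alpha>"
      then have big: "4 < cmod (1 / \<alpha>)"
        using \<alpha> by (simp add: norm_divide field_simps)
      then have "4 * 4 < cmod (1 / \<alpha>) * cmod (1 / \<alpha>)"
        by (intro mult_strict_mono) auto
      then have "16 < cmod (1 / \<alpha>\<^sup>2)"
        by (simp add: norm_divide norm_mult power2_eq_square)
      then have "4 < cmod (1 / \<alpha>\<^sup>2 - y)"
        using y norm_triangle_ineq2[of "1 / \<alpha>\<^sup>2" y] by linarith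
      then have "4 * 4 < cmod (1 / \<alpha>) * cmod (1 / \<alpha>\<^sup>2 - y)"
        using big by (intro mult_strict_mono) auto
      then show False using prod by simp
    qed
  qed
  then show ?thesis
    unfolding kobayashi_royden_def by (intro Inf_greatest) auto
qed

section \<open>The two infinitesimal quantities differ\<close>

theorem proposition1:
  fixes A B :: "complex ^ 3 ^ 3" and \<omega> :: complex and \<Omega> :: "(complex ^ (3 \<times> 3)) set"
  assumes "\<Omega> = vec_of_matrix ` spectral_unit_ball"
    and "\<omega> = exp (2 * of_real pi * \<i> / 3)"
    and "A = vector [vector [0, 0, 0],
                     vector [0, 0, 1],
                     vector [0, 0, 0]]"
    and "B = vector [vector [1, 0, 0],
                     vector [0, \<omega>, 0],
                     vector [0, 0, \<omega>\<^sup>2]]"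
  shows "(kobayashi_royden \<Omega> (vec_of_matrix A) (vec_of_matrix B) > 0 \<and>
          lempert_derivative \<Omega> (vec_of_matrix A) (vec_of_matrix B) = 0) \<and>
         (\<forall>(t :: nat \<Rightarrow> complex) (C :: nat \<Rightarrow> complex ^ 3 ^ 3).
            (\<forall>j. t j \<noteq> 0) \<longrightarrow> t \<longlonglongrightarrow> 0 \<longrightarrow> C \<longlonglongrightarrow> B \<longrightarrow>
            liminf (\<lambda>j. ereal (cmod (C j $ 3 $ 2 / t j - 3))) > 0 \<longrightarrow>
            (\<lambda>j. lempert \<Omega> (vec_of_matrix A) (vec_of_matrix A + t j *s vec_of_matrix (C j))
                   / ereal (cmod (t j))) \<longlonglongrightarrow> 0)"
proof -
  have "\<omega> ^ 3 = exp (of_nat 3 * (2 * of_real pi * \<i> / 3))"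
    unfolding assms(2) exp_of_nat_mult ..
  also have "of_nat 3 * (2 * of_real pi * \<i> / 3) = 2 * of_real pi * \<i>" by simp
  also note exp_two_pi_i
  finally have "(\<omega> - 1) * (1 + \<omega> + \<omega>\<^sup>2) = 0"
    by algebra
  moreover have "\<omega> \<noteq> 1"
  proof
    assume "\<omega> = 1"
    then obtain n :: int where "2 * pi / 3 = of_int (2 * n) * pi"
      unfolding assms(2) exp_eq_1 by auto
    then have "1 = real_of_int (3 * n)" by simp
    then have "1 = 3 * n" by linarith
    then show False by presburger
  qed
  ultimately have \<omega>: "1 + \<omega> + \<omega>\<^sup>2 = 0" by simp
  note limit = lempert_quotient_tendsto_0[OF \<omega> assms(3,4), folded assms(1)]
  have "0 < ereal (1/4)" by simp
  also have "\<dots> \<le> kobayashi_royden \<Omega> (vec_of_matrix A) (vec_of_matrix B)"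
    unfolding assms(1) by (rule kobayashi_royden_ge[OF \<omega> assms(3,4)])
  finally have "kobayashi_royden \<Omega> (vec_of_matrix A) (vec_of_matrix B) > 0" .
  moreover have "((\<lambda>t. lempert \<Omega> (vec_of_matrix A) (vec_of_matrix A + t *s vec_of_matrix B)
      / ereal (cmod t)) \<longlongrightarrow> 0) (at 0)"
    unfolding tendsto_at_iff_sequentially
  proof (intro allI impI)
    fix t :: "nat \<Rightarrow> complex"
    assume "\<forall>j. t j \<in> UNIV - {0}" and "t \<longlonglongrightarrow> 0"
    then show "((\<lambda>t. lempert \<Omega> (vec_of_matrix A) (vec_of_matrix A + t *s vec_of_matrix B)
        / ereal (cmod t)) \<circ> t) \<longlonglongrightarrow> 0"
      unfolding o_def by (intro limit) (auto simp: assms(4) Liminf_const)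
  qed
  then have "lempert_derivative \<Omega> (vec_of_matrix A) (vec_of_matrix B) = 0"
    unfolding lempert_derivative_def by (intro lim_imp_Limsup) auto
  ultimately show ?thesis using limit by blast
qed

end
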